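(* Let $\mathcal I=(t,m,n,\mathcal X,\mathcal X^{(S)},R)$ be an instance of the ICCSI problem over $\mathbb F_q$. For each $i\in[m]$ let $w_i=\dim(\mathcal X^{(i)}\cap\mathcal X^{(S)})$. Let $N$ be a positive integer. (1) If $N\le d_S$ and $\mathcal L$ is an $N$-dimensional subspace of $\mathcal X^{(S)}$ chosen uniformly at random, then the probability that $R_i\in\mathcal L+\mathcal X^{(i)}$ for every $i\in[m]$ is at least $$1-\left[\begin{matrix} d_S \\ N \end{matrix}\right]_q^{-1}\sum_{i=1}^m\sum_{r=0}^{w_i}q^{(w_i+1-r)(N-r)}\left[\begin{matrix} w_i \\ r \end{matrix}\right]_q\left[\begin{matrix} d_S-w_i-1 \\ N-r \end{matrix}\right]_q.$$ (2) In particular, there exists an $\mathbb F_q$-linear $\mathcal I$-IC of length $N$ if $$\sum_{i=1}^m\sum_{r=0}^{w_i}q^{(w_i+1-r)(N-r)}\left[\begin{matrix} w_i \\ r \end{matrix}\right]_q\left[\begin{matrix} d_S-w_i-1 \\ N-r \end{matrix}\right]_q<\left[\begin{matrix} d_S \\ N \end{matrix}\right]_q.$$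
   Context: Notation: $q$ is a prime power, $\mathbb F_q$ the field with $q$ elements, $[m]=\{1,\dots,m\}$. For a matrix $A$, $A_i$ is its $i$-th row and $\langle A\rangle$ its row space. The Gaussian coefficient $\left[\begin{matrix} s \\ r \end{matrix}\right]_q$ is the number of $r$-dimensional subspaces of an $s$-dimensional $\mathbb F_q$-space, equal to $\prod_{j=0}^{r-1}(q^s-q^j)/\prod_{j=0}^{r-1}(q^r-q^j)$ for $s\ge r\ge0$; it is $0$ if $s<r$ or $r<0$. Instance: an instance $\mathcal I=(t,m,n,\mathcal X,\mathcal X^{(S)},R)$ of the Index Coding with Coded Side Information (ICCSI) problem consists of positive integers $t,m,n$; subspaces $\mathcal X^{(S)}$ and $\mathcal X^{(i)}$ ($i\in[m]$) of $\mathbb F_q^n$ of dimensions $d_S$ and $d_i$; $\mathcal X=\{A\in\mathbb F_q^{m\times n}:A_i\in\mathcal X^{(i)},\ i\in[m]\}$; and a matrix $R\in\mathbb F_q^{m\times n}$ with rows $R_i\in\mathcal X^{(S)}\setminus\mathcal X^{(i)}$. Fix matrices $V^{(S)}\in\mathbb F_q^{d_S\times n}$ and $V^{(i)}\in\mathbb F_q^{d_i\times n}$ with $\langle V^{(S)}\rangle=\mathcal X^{(S)}$, $\langle V^{(i)}\rangle=\mathcal X^{(i)}$. Index codes: a map $E:\mathbb F_q^{n\times t}\to\mathbb F_q^{N\times t}$ is an $\mathcal I$-IC of length $N$ if for each $i\in[m]$ there is a decoding map $D_i:\mathbb F_q^{N\times t}\times\mathbb F_q^{d_i\times t}\to\mathbb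 F_q^t$ with $D_i(E(X),V^{(i)}X)=R_iX$ for all $X\in\mathbb F_q^{n\times t}$. It is $\mathbb F_q$-linear if $E(X)=LV^{(S)}X$ for some $L\in\mathbb F_q^{N\times d_S}$. *)

theory Defs
  imports
    "HOL-Probability.Probability_Mass_Function"
    "Jordan_Normal_Form.VS_Connect"
begin

hide_const (open) Finite_Cartesian_Product.row Finite_Cartesian_Product.vec
hide_type (open) Finite_Cartesian_Product.vec

text \<open>The finite field is the type \<open>'a :: {field, finite}\<close>, so that \<open>q = CARD('a)\<close>. The index set
  \<open>{1,\<dots>,m}\<close> is rendered as \<open>{0,\<dots>,m-1}\<close>, matching the numbering of matrix rows in the library.\<close>

abbreviation fq_subspace :: "nat \<Rightarrow> 'a :: field vec set \<Rightarrow> bool" where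
  "fq_subspace n W \<equiv> VectorSpace.subspace class_ring W (module_vec TYPE('a) n)"

abbreviation fq_dim :: "nat \<Rightarrow> 'a :: field vec set \<Rightarrow> nat" where
  "fq_dim n W \<equiv> vectorspace.dim class_ring ((module_vec TYPE('a) n)\<lparr>carrier := W\<rparr>)"

abbreviation fq_sum :: "nat \<Rightarrow> 'a :: field vec set \<Rightarrow> 'a vec set \<Rightarrow> 'a vec set" where
  "fq_sum n U W \<equiv> module.submodule_sum (module_vec TYPE('a) n) U W"

text \<open>Gaussian coefficient. The arguments are integers because a negative lower argument
  does occur (\<open>N - r\<close> with \<open>r > N\<close>), and natural-number subtraction would turn it into \<open>0\<close>.\<close>

definition gauss_coeff :: "'a :: {field, finite} itself \<Rightarrow> int \<Rightarrow> int \<Rightarrow> nat" where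
  "gauss_coeff _ s r =
     (if 0 \<le> r \<and> r \<le> s
      then card {W :: 'a vec set. fq_subspace (nat s) W \<and> fq_dim (nat s) W = nat r}
      else 0)"

definition iccsi_instance ::
  "nat \<Rightarrow> nat \<Rightarrow> nat \<Rightarrow> 'a :: {field, finite} mat set \<Rightarrow> (nat \<Rightarrow> 'a vec set) \<Rightarrow> 'a vec set
     \<Rightarrow> 'a mat \<Rightarrow> bool" where
  "iccsi_instance t m n XX XI XS R \<longleftrightarrow>
     t > 0 \<and> m > 0 \<and> n > 0 \<and>
     fq_subspace n XS \<and>
     (\<forall>i<m. fq_subspace n (XI i)) \<and>
     XX = {A \<in> carrier_mat m n. \<forall>i<m. row A i \<in> XI i} \<and>
     R \<in> carrier_mat m n \<and>
     (\<forall>i<m. row R i \<in> XS - XI i)"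

definition generating_matrix :: "nat \<Rightarrow> 'a :: field vec set \<Rightarrow> 'a mat \<Rightarrow> bool" where
  "generating_matrix n W V \<longleftrightarrow> V \<in> carrier_mat (fq_dim n W) n \<and> vec_space.row_space n V = W"

text \<open>The product of the row vector \<open>R\<^sub>i\<close> with \<open>X\<close> is the \<open>i\<close>-th row of \<open>R * X\<close>.\<close>

definition index_code ::
  "nat \<Rightarrow> nat \<Rightarrow> nat \<Rightarrow> (nat \<Rightarrow> 'a :: {field, finite} vec set) \<Rightarrow> 'a mat \<Rightarrow> (nat \<Rightarrow> 'a mat)
     \<Rightarrow> nat \<Rightarrow> ('a mat \<Rightarrow> 'a mat) \<Rightarrow> bool" where
  "index_code t m n XI R VI N E \<longleftrightarrow>
     E \<in> carrier_mat n t \<rightarrow> carrier_mat N t \<and>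
     (\<forall>i<m. \<exists>D \<in> carrier_mat N t \<times> carrier_mat (fq_dim n (XI i)) t \<rightarrow> carrier_vec t.
        \<forall>X \<in> carrier_mat n t. D (E X, VI i * X) = row (R * X) i)"

definition linear_code ::
  "nat \<Rightarrow> nat \<Rightarrow> 'a :: {field, finite} vec set \<Rightarrow> 'a mat \<Rightarrow> nat \<Rightarrow> ('a mat \<Rightarrow> 'a mat) \<Rightarrow> bool" where
  "linear_code t n XS VS N E \<longleftrightarrow>
     (\<exists>L \<in> carrier_mat N (fq_dim n XS). \<forall>X \<in> carrier_mat n t. E X = L * VS * X)"

end

theory Submission
  imports Defs
begin

text \<open>Put \<open>W = X\<^sup>(\<^sup>i\<^sup>) \<inter> X\<^sup>(\<^sup>S\<^sup>)\<close> and \<open>W' = W + \<langle>R\<^sub>i\<rangle>\<close>. A subspace \<open>L\<close> of \<open>X\<^sup>(\<^sup>S\<^sup>)\<close> is bad for \<open>i\<close>, i.e.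
  \<open>R\<^sub>i \<notin> L + X\<^sup>(\<^sup>i\<^sup>)\<close>, only if \<open>L \<inter> W' = L \<inter> W\<close>. For each \<open>r\<close>-dimensional \<open>U \<subseteq> W\<close> the number of
  \<open>N\<close>-dimensional \<open>L\<close> with \<open>L \<inter> W' = U\<close> is the power of \<open>q\<close> times the Gaussian coefficient in the
  bound, so summing over \<open>U\<close> and applying the union bound over \<open>i\<close> gives (1). For (2), a good \<open>L\<close>
  exists, and any \<open>N\<close> generators of it are the rows of the encoding matrix.

  The count is a double counting of pairs \<open>(v, L)\<close> with \<open>v \<in> L - A\<close>: adjoining \<open>v\<close> to both \<open>U\<close>
  and \<open>A\<close> preserves the condition \<open>L \<inter> A = U\<close> and reduces the codimension of \<open>U\<close> in \<open>L\<close> by one.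
  Taking \<open>U = A = 0\<close> gives the product formula for Gaussian coefficients.\<close>

section \<open>Subspaces of a finite coordinate space and their cardinalities\<close>

text \<open>Coordinates with respect to a finite basis identify the vectors with the scalar
  functions on that basis; \<open>basis_criterion\<close> supplies existence and uniqueness.
  Extensional functions are used so that each coordinate tuple is represented once.\<close>

lemma (in vectorspace) card_carrier_eq_power_dim:
  assumes "fin_dim" and "finite (carrier K)"
  shows "finite (carrier V)" and "card (carrier V) = card (carrier K) ^ dim"
proof -
  obtain B where B: "finite B" "basis B"
    using finite_basis_exists[OF assms(1)] by blast
  then have BV: "B \<subseteq> carrier V" by (simp add: basis_def)
  have uniq: "\<forall>v. v \<in> carrier V \<longrightarrow> (\<exists>!a. a \<in> B \<rightarrow>\<^sub>E carrier K \<and> lincomb a B = v)"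
    using basis_criterion[OF B(1) BV] B(2) by simp
  have closed: "lincomb a B \<in> carrier V" if "a \<in> B \<rightarrow>\<^sub>E carrier K" for a
    using that BV by (intro lincomb_closed) auto
  have "bij_betw (\<lambda>a. lincomb a B) (B \<rightarrow>\<^sub>E carrier K) (carrier V)"
    unfolding bij_betw_def inj_on_def
  proof (intro conjI ballI impI)
    fix a b assume "a \<in> B \<rightarrow>\<^sub>E carrier K" "b \<in> B \<rightarrow>\<^sub>E carrier K" "lincomb a B = lincomb b B"
    then show "a = b" using uniq closed by metis
  next
    show "(\<lambda>a. lincomb a B) ` (B \<rightarrow>\<^sub>E carrier K) = carrier V"
      using uniq closed by (auto simp: image_iff)
  qed
  then show "finite (carrier V)" and "card (carrier V) = card (carrier K) ^ dim"
    using bij_betw_finite bij_betw_same_card finite_PiE[OF B(1), of "\<lambda>_. carrier K"] assms(2)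
      card_funcsetE[OF B(1)] dim_basis[OF B] by metis+
qed

lemma finite_carrier_vec: "finite (carrier_vec n :: 'a :: {field, finite} vec set)"
proof -
  interpret vec_space "TYPE('a)" n .
  show ?thesis using card_carrier_eq_power_dim(1)[OF fin_dim] by simp
qed

lemma fq_subspace_iff:
  "fq_subspace n W \<longleftrightarrow> W \<subseteq> carrier_vec n \<and> 0\<^sub>v n \<in> W \<and>
     (\<forall>u\<in>W. \<forall>v\<in>W. u + v \<in> W) \<and> (\<forall>c. \<forall>v\<in>W. c \<cdot>\<^sub>v v \<in> W)"
  for W :: "'a :: field vec set"
  using vec_vs[of n, where 'a='a] vec_module[of n, where 'a='a]
  by (auto simp: VectorSpace.subspace_def submodule_def module_vec_simps)

lemma fq_subspaceD:
  fixes W :: "'a :: field vec set"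
  assumes "fq_subspace n W"
  shows "W \<subseteq> carrier_vec n" "0\<^sub>v n \<in> W"
    "\<And>u v. u \<in> W \<Longrightarrow> v \<in> W \<Longrightarrow> u + v \<in> W" "\<And>c v. v \<in> W \<Longrightarrow> c \<cdot>\<^sub>v v \<in> W"
    "\<And>u v. u \<in> W \<Longrightarrow> v \<in> W \<Longrightarrow> u - v \<in> W"
proof -
  show *: "W \<subseteq> carrier_vec n" "0\<^sub>v n \<in> W"
    "\<And>u v. u \<in> W \<Longrightarrow> v \<in> W \<Longrightarrow> u + v \<in> W" "\<And>c v. v \<in> W \<Longrightarrow> c \<cdot>\<^sub>v v \<in> W"
    using assms by (auto simp: fq_subspace_iff)
  show "u - v \<in> W" if "u \<in> W" "v \<in> W" for u v
  proof -
    have "u - v = u + (- 1) \<cdot>\<^sub>v v" using that *(1) by (intro eq_vecI) auto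
    then show ?thesis using *(3,4) that by metis
  qed
qed

lemma fq_subspace_finite: "fq_subspace n W \<Longrightarrow> finite W" for W :: "'a :: {field, finite} vec set"
  using fq_subspaceD(1) finite_carrier_vec finite_subset by metis

lemma fq_subspace_basis:
  fixes W :: "'a :: {field, finite} vec set"
  assumes "fq_subspace n W"
  shows "card W = CARD('a) ^ fq_dim n W"
    and "\<exists>B. finite B \<and> card B = fq_dim n W \<and> B \<subseteq> W \<and>
           LinearCombinations.module.span class_ring (module_vec TYPE('a) n) B = W"
proof -
  interpret vec_space "TYPE('a)" n .
  interpret W: vectorspace class_ring "vs W" by (rule subspace_is_vs[OF assms])
  have sub: "LinearCombinations.submodule class_ring W V" using assms by (simp add: VectorSpace.subspace_def)
  \<comment> \<open>Being finite, \<open>W\<close> is its own finite generating set; this yields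
    finite dimension without reference to the ambient space.\<close>
  have "W.span W = W"
    using W.in_own_span[of W] W.span_is_subset2[of W] by auto
  then have fd: "W.fin_dim"
    unfolding W.fin_dim_def using fq_subspace_finite[OF assms] by auto
  show "card W = CARD('a) ^ fq_dim n W"
    using W.card_carrier_eq_power_dim(2)[OF fd] by simp
  obtain B where B: "finite B" "W.basis B" using W.finite_basis_exists[OF fd] by blast
  then have "B \<subseteq> W" "W.span B = W" by (auto simp: W.basis_def)
  then show "\<exists>B. finite B \<and> card B = fq_dim n W \<and> B \<subseteq> W \<and> span B = W"
    using span_li_not_depend(1)[OF _ sub] B W.dim_basis[OF B] by auto
qed

lemma card_field_gt_1: "1 < CARD('a :: {field, finite})"
  using card_mono[of UNIV "{0 :: 'a, 1}"] by simp

text \<open>Exponents of \<open>q\<close> can be compared because \<open>q > 1\<close>. This allows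
  the counting below to speak of cardinalities and return to dimensions only at the end.\<close>

lemma fq_dim_eq_iff_card:
  fixes W :: "'a :: {field, finite} vec set"
  assumes "fq_subspace n W"
  shows "fq_dim n W = d \<longleftrightarrow> card W = CARD('a) ^ d"
  using fq_subspace_basis(1)[OF assms] card_field_gt_1[where 'a='a] by simp

lemma fq_subspace_carrier: "fq_subspace n (carrier_vec n :: 'a :: field vec set)"
  by (auto simp: fq_subspace_iff)

lemma fq_subspace_zero: "fq_subspace n {0\<^sub>v n :: 'a :: field vec}"
  by (auto simp: fq_subspace_iff)

lemma fq_subspace_Int: "fq_subspace n U \<Longrightarrow> fq_subspace n W \<Longrightarrow> fq_subspace n (U \<inter> W)"
  for U W :: "'a :: field vec set"
  by (auto simp: fq_subspace_iff)

lemma card_carrier_vec: "card (carrier_vec n :: 'a :: {field, finite} vec set) = CARD('a) ^ n"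
proof -
  interpret vec_space "TYPE('a)" n .
  show ?thesis using card_carrier_eq_power_dim(2)[OF fin_dim] by (simp add: dim_is_n)
qed

section \<open>Adjoining one vector to a subspace\<close>

definition extend_span :: "'a :: field vec set \<Rightarrow> 'a vec \<Rightarrow> 'a vec set" where
  "extend_span U v = {u + c \<cdot>\<^sub>v v | u c. u \<in> U}"

lemma extend_spanI: "u \<in> U \<Longrightarrow> u + c \<cdot>\<^sub>v v \<in> extend_span U v"
  by (auto simp: extend_span_def)

lemma subspace_subset_extend_span:
  fixes U :: "'a :: field vec set"
  assumes "fq_subspace n U" "v \<in> carrier_vec n"
  shows "U \<subseteq> extend_span U v"
proof
  fix u assume "u \<in> U"
  moreover have "u = u + 0 \<cdot>\<^sub>v v" using calculation assms fq_subspaceD(1) by fastforce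
  ultimately show "u \<in> extend_span U v" using extend_spanI by metis
qed

lemma in_extend_span:
  fixes U :: "'a :: field vec set"
  assumes "fq_subspace n U" "v \<in> carrier_vec n"
  shows "v \<in> extend_span U v"
  using extend_spanI[OF fq_subspaceD(2)[OF assms(1)], of 1 v] assms(2) by simp

lemma extend_span_subset:
  fixes L :: "'a :: field vec set"
  assumes "fq_subspace n L" "U \<subseteq> L" "v \<in> L"
  shows "extend_span U v \<subseteq> L"
  using assms fq_subspaceD(3,4)[OF assms(1)] by (auto simp: extend_span_def)

lemma fq_subspace_extend_span:
  fixes U :: "'a :: field vec set"
  assumes "fq_subspace n U" "v \<in> carrier_vec n"
  shows "fq_subspace n (extend_span U v)"
  unfolding fq_subspace_iff
proof (intro conjI ballI allI)
  note U = fq_subspaceD[OF assms(1)]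
  show "extend_span U v \<subseteq> carrier_vec n"
    using U(1) assms(2) by (auto simp: extend_span_def)
  show "0\<^sub>v n \<in> extend_span U v"
    using subspace_subset_extend_span[OF assms] U(2) by blast
  fix x c assume "x \<in> extend_span U v"
  then obtain u a where x: "x = u + a \<cdot>\<^sub>v v" "u \<in> U" by (auto simp: extend_span_def)
  have "c \<cdot>\<^sub>v x = c \<cdot>\<^sub>v u + (c * a) \<cdot>\<^sub>v v"
    unfolding x using x(2) U(1) assms(2)
    by (simp add: smult_add_distrib_vec[where n = n] smult_smult_assoc subset_iff)
  then show "c \<cdot>\<^sub>v x \<in> extend_span U v" using extend_spanI U(4) x(2) by metis
  fix y assume "y \<in> extend_span U v"
  then obtain w b where y: "y = w + b \<cdot>\<^sub>v v" "w \<in> U" by (auto simp: extend_span_def)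
  have "x + y = (u + w) + (a + b) \<cdot>\<^sub>v v"
    unfolding x y using x(2) y(2) U(1) assms(2) by (intro eq_vecI) (auto simp: algebra_simps)
  then show "x + y \<in> extend_span U v" using extend_spanI U(3) x(2) y(2) by metis
qed

text \<open>Subtracting \<open>u\<close> leaves a multiple of \<open>v\<close> in \<open>U\<close>;
  a nonzero \<open>c\<close> could be inverted, which would put \<open>v\<close> itself into
  \<open>U\<close>.\<close>

lemma add_smult_mem_iff:
  fixes U :: "'a :: field vec set"
  assumes U: "fq_subspace n U" and v: "v \<in> carrier_vec n" "v \<notin> U" and u: "u \<in> U"
  shows "u + c \<cdot>\<^sub>v v \<in> U \<longleftrightarrow> c = 0"
proof
  note UD = fq_subspaceD[OF U]
  assume "u + c \<cdot>\<^sub>v v \<in> U"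
  then have "u + c \<cdot>\<^sub>v v - u \<in> U" using UD(5) u by blast
  moreover have "u + c \<cdot>\<^sub>v v - u = c \<cdot>\<^sub>v v" using u UD(1) v(1) by (intro eq_vecI) auto
  ultimately have "inverse c \<cdot>\<^sub>v (c \<cdot>\<^sub>v v) \<in> U" using UD(4) by simp
  then show "c = 0" using v by (cases "c = 0") (simp_all add: smult_smult_assoc)
next
  assume "c = 0"
  moreover have "u + 0 \<cdot>\<^sub>v v = u" using u v(1) fq_subspaceD(1)[OF U] by (intro eq_vecI) auto
  ultimately show "u + c \<cdot>\<^sub>v v \<in> U" using u by simp
qed

lemma card_extend_span:
  fixes U :: "'a :: {field, finite} vec set"
  assumes U: "fq_subspace n U" and v: "v \<in> carrier_vec n" "v \<notin> U"
  shows "card (extend_span U v) = CARD('a) * card U"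
proof -
  note UD = fq_subspaceD[OF U]
  have "inj_on (\<lambda>(u, c). u + c \<cdot>\<^sub>v v) (U \<times> UNIV)"
  proof (rule inj_onI, clarify)
    fix u w :: "'a vec" and a b :: 'a
    assume uw: "u \<in> U" "w \<in> U" and eq: "u + a \<cdot>\<^sub>v v = w + b \<cdot>\<^sub>v v"
    have dims: "u \<in> carrier_vec n" "w \<in> carrier_vec n" using uw UD(1) by auto
    have idx: "u $ i + a * v $ i = w $ i + b * v $ i" if "i < n" for i
      using arg_cong[OF eq, of "\<lambda>x. x $ i"] that dims v by simp
    \<comment> \<open>Rearranged so that a vector of \<open>U\<close> plus a multiple of
      \<open>v\<close> lies in \<open>U\<close>, which forces the multiple \<open>a - b\<close> to
      vanish.\<close>
    have "u + (a - b) \<cdot>\<^sub>v v = w"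
      using dims v idx by (intro eq_vecI) (auto simp: algebra_simps eq_diff_eq)
    then have "a = b" using add_smult_mem_iff[OF U v uw(1), of "a - b"] uw(2) by simp
    moreover have "u = w" using idx calculation dims by (intro eq_vecI) auto
    ultimately show "u = w \<and> a = b" by simp
  qed
  moreover have "extend_span U v = (\<lambda>(u, c). u + c \<cdot>\<^sub>v v) ` (U \<times> UNIV)"
    by (auto simp: extend_span_def)
  ultimately show ?thesis by (simp add: card_image card_cartesian_product)
qed

text \<open>From right to left this is the modular law: as \<open>v\<close> lies in
  \<open>L\<close>, it can be subtracted from an element of the intersection without leaving
  \<open>L\<close>. From left to right, an element of \<open>L\<close> and \<open>A\<close> has the
  form \<open>u + c v\<close>, and \<open>v\<close> outside \<open>A\<close> forces
  \<open>c = 0\<close>.\<close>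

lemma Int_extend_span_eq_iff:
  fixes L :: "'a :: field vec set"
  assumes L: "fq_subspace n L" and A: "fq_subspace n A" and UA: "U \<subseteq> A"
    and v: "v \<in> carrier_vec n" "v \<notin> A" "v \<in> L"
  shows "L \<inter> extend_span A v = extend_span U v \<longleftrightarrow> L \<inter> A = U"
proof
  note AD = fq_subspaceD[OF A]
  assume eq: "L \<inter> extend_span A v = extend_span U v"
  have "U \<subseteq> L"
  proof
    fix u assume u: "u \<in> U"
    then have "u = u + 0 \<cdot>\<^sub>v v" using UA AD(1) v(1) by fastforce
    then show "u \<in> L" using extend_spanI[OF u, of 0 v] eq by auto
  qed
  moreover have "x \<in> U" if "x \<in> L" "x \<in> A" for x
  proof -
    have "x \<in> extend_span U v"
      using that eq subspace_subset_extend_span[OF A v(1)] by blast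
    then obtain u c where x: "x = u + c \<cdot>\<^sub>v v" "u \<in> U" by (auto simp: extend_span_def)
    then have "c = 0" using add_smult_mem_iff[OF A v(1,2), of u c] that(2) UA by auto
    then have "x = u" using x UA AD(1) v(1) by (auto intro!: eq_vecI)
    then show ?thesis using x(2) by simp
  qed
  ultimately show "L \<inter> A = U" using UA by blast
next
  note LD = fq_subspaceD[OF L] and AD = fq_subspaceD[OF A]
  assume eq: "L \<inter> A = U"
  have "x \<in> extend_span U v" if xL: "x \<in> L" and xA: "x \<in> extend_span A v" for x
  proof -
    obtain a c where x: "x = a + c \<cdot>\<^sub>v v" "a \<in> A" using xA by (auto simp: extend_span_def)
    have "x - c \<cdot>\<^sub>v v \<in> L" using LD xL v(3) by auto
    moreover have "x - c \<cdot>\<^sub>v v = a" unfolding x using x(2) AD(1) v(1) by (intro eq_vecI) auto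
    ultimately have "a \<in> U" using x(2) eq by auto
    then show ?thesis unfolding x(1) by (rule extend_spanI)
  qed
  moreover have "extend_span U v \<subseteq> L" using extend_span_subset[OF L _ v(3)] eq by blast
  moreover have "extend_span U v \<subseteq> extend_span A v" using UA by (auto simp: extend_span_def)
  ultimately show "L \<inter> extend_span A v = extend_span U v" by blast
qed


section \<open>Counting subspaces with a prescribed intersection\<close>

text \<open>The right product counts the ordered \<open>k\<close>-tuples in \<open>V\<close> that
  are independent modulo \<open>A\<close>; each of them together with \<open>U\<close> spans one
  admissible \<open>L\<close>. The left product counts the tuples that yield the same
  \<open>L\<close>. Keeping it as a factor avoids division. If \<open>a + k > s\<close>, the right
  product contains the zero factor \<open>j = s - a\<close>.\<close>

lemma card_subspaces_with_Int:
  fixes V U A :: "'a :: {field, finite} vec set"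
  assumes V: "fq_subspace n V" "card V = CARD('a) ^ s"
    and U: "fq_subspace n U" "card U = CARD('a) ^ r"
    and A: "fq_subspace n A" "card A = CARD('a) ^ a"
    and sub: "U \<subseteq> A" "A \<subseteq> V"
  shows "real (card {L. fq_subspace n L \<and> L \<subseteq> V \<and> card L = CARD('a) ^ (r + k) \<and> L \<inter> A = U}) *
           (\<Prod>j<k. real CARD('a) ^ (r + k) - real CARD('a) ^ (r + j)) =
         (\<Prod>j<k. real CARD('a) ^ s - real CARD('a) ^ (a + j))"
  using U A sub
proof (induction k arbitrary: U A r a)
  case 0
  have "{L. fq_subspace n L \<and> L \<subseteq> V \<and> card L = CARD('a) ^ r \<and> L \<inter> A = U} = {U}"
  proof -
    have "L = U" if "fq_subspace n L" "card L = CARD('a) ^ r" "L \<inter> A = U" for L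
      using card_subset_eq[OF fq_subspace_finite[OF that(1)], of U] that 0 by auto
    then show ?thesis using 0 by auto
  qed
  then show ?case by simp
next
  case (Suc k)
  let ?q = "real CARD('a)"
  \<comment> \<open>The dimension of \<open>L\<close> stays fixed in the induction: \<open>r\<close>
    grows by one while \<open>k\<close> shrinks by one.\<close>
  define N where "N = r + Suc k"
  define S where "S U A = {L. fq_subspace n L \<and> L \<subseteq> V \<and> card L = CARD('a) ^ N \<and> L \<inter> A = U}"
    for U A :: "'a vec set"
  define c where "c = (\<Prod>j<k. ?q ^ N - ?q ^ (Suc r + j))"
  have fin: "finite (S U A)" "finite V" for U A
    using fq_subspace_finite[OF V(1)] by (auto simp: S_def)
  have SV: "{L \<in> S U A. v \<in> L} = S (extend_span U v) (extend_span A v)" if v: "v \<in> V - A" for v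
  proof -
    have vc: "v \<in> carrier_vec n" "v \<notin> A" using v fq_subspaceD(1)[OF V(1)] by auto
    have "v \<in> extend_span U v" using in_extend_span[OF Suc.prems(1) vc(1)] .
    then show ?thesis
      using Int_extend_span_eq_iff[OF _ Suc.prems(3,5) vc] by (auto simp: S_def)
  qed
  have step: "real (card (S (extend_span U v) (extend_span A v))) * c =
      (\<Prod>j<k. ?q ^ s - ?q ^ (Suc a + j))" if v: "v \<in> V - A" for v
  proof -
    have vc: "v \<in> carrier_vec n" "v \<notin> A" "v \<notin> U" using v fq_subspaceD(1)[OF V(1)] Suc.prems by auto
    show ?thesis
      using Suc.IH[of "extend_span U v" "Suc r" "extend_span A v" "Suc a"]
        fq_subspace_extend_span[OF _ vc(1)] card_extend_span[OF _ vc(1)] vc Suc.prems v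
        extend_span_subset[OF V(1)]
      by (auto simp: S_def c_def N_def extend_span_def)
  qed
  \<comment> \<open>The pairs \<open>(v, L)\<close> are counted by \<open>L\<close> and by
    \<open>v\<close>. For fixed \<open>L\<close> the vectors form \<open>L - U\<close>, since
    \<open>L\<close> meets \<open>A\<close> exactly in \<open>U\<close>; for fixed \<open>v\<close>,
    \<open>SV\<close> and the induction hypothesis apply.\<close>
  have "(\<Sum>L\<in>S U A. card {v \<in> V - A. v \<in> L}) = (\<Sum>v\<in>V - A. card {L \<in> S U A. v \<in> L})"
    using fin by (intro sum_multicount_gen) auto
  moreover have "real (card {v \<in> V - A. v \<in> L}) = ?q ^ N - ?q ^ r" if "L \<in> S U A" for L
  proof -
    have L: "fq_subspace n L" "card L = CARD('a) ^ N" "L \<inter> A = U" "L \<subseteq> V" using that by (auto simp: S_def)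
    then have "{v \<in> V - A. v \<in> L} = L - U" "U \<subseteq> L" by auto
    then show ?thesis
      using card_Diff_subset[of U L] card_mono[of L U] fq_subspace_finite[OF L(1)] L Suc.prems(2)
        finite_subset[of U L] by (simp add: of_nat_diff)
  qed
  ultimately have "real (card (S U A)) * (?q ^ N - ?q ^ r) =
      real (\<Sum>v\<in>V - A. card {L \<in> S U A. v \<in> L})"
    by (metis (no_types, lifting) of_nat_sum sum_constant sum.cong)
  also have "\<dots> = (\<Sum>v\<in>V - A. real (card (S (extend_span U v) (extend_span A v))))"
    unfolding of_nat_sum using SV by (intro sum.cong) (simp_all del: Diff_iff)
  finally have "real (card (S U A)) * (?q ^ N - ?q ^ r) =
      (\<Sum>v\<in>V - A. real (card (S (extend_span U v) (extend_span A v))))" .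
  then have "real (card (S U A)) * (?q ^ N - ?q ^ r) * c =
      (\<Sum>v\<in>V - A. real (card (S (extend_span U v) (extend_span A v))) * c)"
    by (simp add: sum_distrib_right)
  also have "\<dots> = real (card (V - A)) * (\<Prod>j<k. ?q ^ s - ?q ^ (Suc a + j))"
    using step by simp
  also have "real (card (V - A)) = ?q ^ s - ?q ^ a"
    using card_Diff_subset[of A V] card_mono[of V A] fin(2) finite_subset[of A V] Suc.prems V(2)
    by (simp add: of_nat_diff)
  \<comment> \<open>The factors obtained from \<open>V - A\<close> and from \<open>L - U\<close> are
    the \<open>j = 0\<close> factors of the two products.\<close>
  finally show ?case
    unfolding prod.lessThan_Suc_shift by (simp add: c_def S_def N_def mult.assoc)
qed

lemma prod_power_diff_nonzero:
  fixes q :: real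
  assumes "1 < q"
  shows "(\<Prod>j<k. q ^ (r + k) - q ^ (r + j)) \<noteq> 0"
  using assms by (auto simp: power_add)

section \<open>Gaussian coefficients\<close>

lemma gauss_coeff_eq:
  assumes "r \<le> s"
  shows "real (gauss_coeff TYPE('a :: {field, finite}) (int s) (int r)) *
           (\<Prod>j<r. real CARD('a) ^ r - real CARD('a) ^ j) =
         (\<Prod>j<r. real CARD('a) ^ s - real CARD('a) ^ j)"
proof -
  \<comment> \<open>Every subspace meets the zero space in the zero space, so the added intersection
    condition only brings the set into the form of the general count.\<close>
  have "{W :: 'a vec set. fq_subspace s W \<and> fq_dim s W = r} =
      {L. fq_subspace s L \<and> L \<subseteq> carrier_vec s \<and> card L = CARD('a) ^ (0 + r) \<and>
        L \<inter> {0\<^sub>v s} = {0\<^sub>v s}}"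
    using fq_dim_eq_iff_card[where 'a = 'a] fq_subspaceD(1,2)[where 'a = 'a] by fastforce
  then show ?thesis
    using card_subspaces_with_Int[OF fq_subspace_carrier card_carrier_vec fq_subspace_zero _
        fq_subspace_zero, where 'a = 'a and n = s and r = 0 and a = 0 and k = r] assms
    by (simp add: gauss_coeff_def)
qed

text \<open>No factor of the numerator vanishes when \<open>r \<le> s\<close>. This later makes the
  set of candidate subspaces nonempty, as the uniform distribution requires.\<close>

lemma gauss_coeff_pos:
  assumes "r \<le> s"
  shows "0 < gauss_coeff TYPE('a :: {field, finite}) (int s) (int r)"
proof -
  have "(\<Prod>j<r. real CARD('a) ^ s - real CARD('a) ^ j) \<noteq> 0"
    using assms card_field_gt_1[where 'a = 'a] by auto
  then show ?thesis using gauss_coeff_eq[OF assms, where 'a = 'a]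
    by (metis mult_eq_0_iff of_nat_0 gr0I)
qed

text \<open>With \<open>k = N - r\<close>, the factor \<open>q^(r k)\<close> splits off the left
  product of the general count and \<open>q^(a k)\<close> off the right one. Their quotient is the
  stated power, and what remains is the product formula for the Gaussian coefficient of
  \<open>s - a\<close> and \<open>k\<close>.\<close>

lemma card_subspaces_with_Int_eq_gauss_coeff:
  fixes V U A :: "'a :: {field, finite} vec set"
  assumes V: "fq_subspace n V" and U: "fq_subspace n U" and A: "fq_subspace n A"
    and sub: "U \<subseteq> A" "A \<subseteq> V" and N: "fq_dim n U \<le> N"
  shows "real (card {L. fq_subspace n L \<and> L \<subseteq> V \<and> fq_dim n L = N \<and> L \<inter> A = U}) =
    real CARD('a) ^ ((fq_dim n A - fq_dim n U) * (N - fq_dim n U)) *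
    real (gauss_coeff TYPE('a) (int (fq_dim n V) - int (fq_dim n A)) (int N - int (fq_dim n U)))"
    (is "?c = _ * ?g")
proof -
  let ?q = "real CARD('a)"
  define s r a k where "s = fq_dim n V" and "r = fq_dim n U" and "a = fq_dim n A" and "k = N - r"
  have q: "1 < ?q" using card_field_gt_1[where 'a = 'a] by simp
  have card: "card V = CARD('a) ^ s" "card U = CARD('a) ^ r" "card A = CARD('a) ^ a"
    unfolding s_def r_def a_def using fq_subspace_basis(1) V U A by auto
  have le: "r \<le> a" "a \<le> s"
    using card_mono[OF fq_subspace_finite[OF A] sub(1)] card_mono[OF fq_subspace_finite[OF V] sub(2)]
      card card_field_gt_1[where 'a = 'a] by auto
  have Nk: "N = r + k" using N by (simp add: k_def r_def)
  have "{L. fq_subspace n L \<and> L \<subseteq> V \<and> fq_dim n L = N \<and> L \<inter> A = U} =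
      {L. fq_subspace n L \<and> L \<subseteq> V \<and> card L = CARD('a) ^ (r + k) \<and> L \<inter> A = U}"
    using fq_dim_eq_iff_card Nk by auto
  then have *: "?c * (\<Prod>j<k. ?q ^ (r + k) - ?q ^ (r + j)) = (\<Prod>j<k. ?q ^ s - ?q ^ (a + j))"
    using card_subspaces_with_Int[OF V card(1) U card(2) A card(3) sub] by simp
  have g: "?g * (\<Prod>j<k. ?q ^ k - ?q ^ j) = (\<Prod>j<k. ?q ^ (s - a) - ?q ^ j)"
  proof (cases "k \<le> s - a")
    case True
    then show ?thesis
      using gauss_coeff_eq[OF True, where 'a = 'a] le Nk
      by (simp add: of_nat_diff flip: s_def r_def a_def)
  next
    case False
    then have "?g = 0" using le Nk by (simp add: gauss_coeff_def flip: s_def r_def a_def)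
    \<comment> \<open>The index \<open>j = s - a\<close> is below \<open>k\<close> and gives a zero
      factor, in agreement with the default value of \<open>gauss_coeff\<close>.\<close>
    moreover have "(\<Prod>j<k. ?q ^ (s - a) - ?q ^ j) = 0"
      using False by (intro prod_zero) (auto intro!: bexI[of _ "s - a"])
    ultimately show ?thesis by simp
  qed
  have 1: "(\<Prod>j<k. ?q ^ (r + k) - ?q ^ (r + j)) = ?q ^ (r * k) * (\<Prod>j<k. ?q ^ k - ?q ^ j)"
    by (simp add: power_add power_mult prod.distrib flip: right_diff_distrib)
  have 2: "(\<Prod>j<k. ?q ^ s - ?q ^ (a + j)) = ?q ^ (a * k) * (\<Prod>j<k. ?q ^ (s - a) - ?q ^ j)"
  proof -
    have "?q ^ s - ?q ^ (a + j) = ?q ^ a * (?q ^ (s - a) - ?q ^ j)" for j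
      using le by (simp add: right_diff_distrib flip: power_add)
    then show ?thesis by (simp add: prod.distrib power_mult)
  qed
  have 3: "?q ^ (a * k) = ?q ^ (r * k) * ?q ^ ((a - r) * k)"
    using le by (simp flip: power_add add_mult_distrib)
  have "?q ^ (r * k) * (\<Prod>j<k. ?q ^ k - ?q ^ j) * ?c =
      ?q ^ (r * k) * (\<Prod>j<k. ?q ^ k - ?q ^ j) * (?q ^ ((a - r) * k) * ?g)"
    using * unfolding 1 2 g[symmetric] 3 by (simp add: mult_ac)
  moreover have "?q ^ (r * k) * (\<Prod>j<k. ?q ^ k - ?q ^ j) \<noteq> 0"
    using prod_power_diff_nonzero[OF q, of r k] unfolding 1 .
  ultimately have "?c = ?q ^ ((a - r) * k) * ?g"
    using mult_left_cancel by blast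
  then show ?thesis by (simp add: k_def flip: s_def r_def a_def)
qed

text \<open>Carries the coefficient, defined through a full coordinate space, over to an arbitrary
  subspace \<open>V\<close> of the same dimension. The case \<open>U = A = 0\<close> makes the
  exponent of \<open>q\<close> zero.\<close>

lemma card_subspaces_eq_gauss_coeff:
  fixes V :: "'a :: {field, finite} vec set"
  assumes V: "fq_subspace n V"
  shows "card {L. fq_subspace n L \<and> L \<subseteq> V \<and> fq_dim n L = N} =
    gauss_coeff TYPE('a) (int (fq_dim n V)) (int N)"
proof -
  have dim0: "fq_dim n {0\<^sub>v n :: 'a vec} = 0"
    using fq_dim_eq_iff_card[OF fq_subspace_zero, of n 0, where 'a = 'a] by simp
  have "{L. fq_subspace n L \<and> L \<subseteq> V \<and> fq_dim n L = N \<and> L \<inter> {0\<^sub>v n} = {0\<^sub>v n}} =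
      {L. fq_subspace n L \<and> L \<subseteq> V \<and> fq_dim n L = N}"
    using fq_subspaceD(2)[where 'a = 'a] by blast
  then show ?thesis
    using card_subspaces_with_Int_eq_gauss_coeff[OF V fq_subspace_zero fq_subspace_zero, of N]
      fq_subspaceD(2)[OF V] dim0 by simp
qed

section \<open>Bad subspaces for a single receiver\<close>

lemma fq_sum_eq: "fq_sum n U W = {u + w | u w. u \<in> U \<and> w \<in> W}" for U W :: "'a :: field vec set"
proof -
  interpret vec_space "TYPE('a)" n .
  show ?thesis by (auto simp: submodule_sum_def)
qed


text \<open>An element \<open>w + c v\<close> of \<open>L\<close> with \<open>w\<close> in
  \<open>X\<close> and \<open>c\<close> nonzero could be solved for \<open>v\<close>, exhibiting
  \<open>v\<close> in \<open>L + X\<close>.\<close>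

lemma Int_extend_span_eq_if_notin_fq_sum:
  fixes L X S :: "'a :: field vec set"
  assumes L: "fq_subspace n L" "L \<subseteq> S" and X: "fq_subspace n X" and S: "fq_subspace n S"
    and v: "v \<in> S" "v \<notin> fq_sum n L X"
  shows "L \<inter> extend_span (X \<inter> S) v = L \<inter> (X \<inter> S)"
proof -
  have vc: "v \<in> carrier_vec n" using v fq_subspaceD(1)[OF S] by auto
  have "x \<in> X \<inter> S" if xL: "x \<in> L" and xE: "x \<in> extend_span (X \<inter> S) v" for x
  proof -
    obtain w c where x: "x = w + c \<cdot>\<^sub>v v" and w: "w \<in> X" "w \<in> S"
      using xE by (auto simp: extend_span_def)
    have wc: "w \<in> carrier_vec n" using w fq_subspaceD(1)[OF X] by auto
    have "c = 0"
    proof (rule ccontr)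
      assume c: "c \<noteq> 0"
      have "v = inverse c \<cdot>\<^sub>v x + (- inverse c) \<cdot>\<^sub>v w"
        unfolding x using wc vc c by (intro eq_vecI) (auto simp: algebra_simps)
      moreover have "inverse c \<cdot>\<^sub>v x \<in> L" "(- inverse c) \<cdot>\<^sub>v w \<in> X"
        using xL w fq_subspaceD(4) L(1) X by blast+
      ultimately show False using v(2) unfolding fq_sum_eq by blast
    qed
    then have "x = w" unfolding x using wc vc by (intro eq_vecI) auto
    then show ?thesis using w by simp
  qed
  moreover have "X \<inter> S \<subseteq> extend_span (X \<inter> S) v"
    using subspace_subset_extend_span[OF fq_subspace_Int[OF X S] vc] .
  ultimately show ?thesis by blast
qed

text \<open>Bad subspaces are sorted by \<open>U\<close>, their intersection with \<open>W'\<close>,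
  and then by \<open>r\<close>, the dimension of \<open>U\<close>. There are as many
  \<open>U\<close> as the first coefficient says, and each contributes the power times the second
  one. Since \<open>W'\<close> has dimension \<open>w + 1\<close>, the exponent contains
  \<open>w + 1 - r\<close> and the last coefficient \<open>d - w - 1\<close>.\<close>

lemma card_subspaces_notin_fq_sum_le:
  fixes S X :: "'a :: {field, finite} vec set"
  assumes S: "fq_subspace n S" and X: "fq_subspace n X" and v: "v \<in> S - X"
  defines "w \<equiv> fq_dim n (X \<inter> S)" and "d \<equiv> fq_dim n S"
  shows "real (card {L. fq_subspace n L \<and> L \<subseteq> S \<and> fq_dim n L = N \<and> v \<notin> fq_sum n L X}) \<le>
    (\<Sum>r=0..w. real CARD('a) powi ((int w + 1 - int r) * (int N - int r)) *
       real (gauss_coeff TYPE('a) (int w) (int r)) *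
       real (gauss_coeff TYPE('a) (int d - int w - 1) (int N - int r)))"
    (is "real (card ?B) \<le> (\<Sum>r=0..w. ?t r * _ * ?g r)")
proof -
  define W where "W = X \<inter> S"
  define W' where "W' = extend_span W v"
  define T where "T U = {L. fq_subspace n L \<and> L \<subseteq> S \<and> fq_dim n L = N \<and> L \<inter> W' = U}" for U
  define G where "G r = {U. fq_subspace n U \<and> U \<subseteq> W \<and> fq_dim n U = r}" for r
  have W: "fq_subspace n W" unfolding W_def using X S by (rule fq_subspace_Int)
  have vc: "v \<in> carrier_vec n" "v \<notin> W" using v fq_subspaceD(1)[OF S] by (auto simp: W_def)
  have W': "fq_subspace n W'" unfolding W'_def using W vc(1) by (rule fq_subspace_extend_span)
  have WW': "W \<subseteq> W'" unfolding W'_def using subspace_subset_extend_span[OF W vc(1)] .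
  have W'S: "W' \<subseteq> S" unfolding W'_def using extend_span_subset[OF S] v by (auto simp: W_def)
  have dimW': "fq_dim n W' = Suc w"
    using fq_dim_eq_iff_card[OF W'] card_extend_span[OF W vc] fq_subspace_basis(1)[OF W]
    by (simp add: W'_def w_def flip: W_def)
  have finG: "finite (G r)" for r using fq_subspace_finite[OF W] by (simp add: G_def)
  have finT: "finite (T U)" for U using fq_subspace_finite[OF S] by (simp add: T_def)
  have dim_mono: "fq_dim n U \<le> fq_dim n V" if "fq_subspace n U" "fq_subspace n V" "U \<subseteq> V"
    for U V :: "'a vec set"
    using card_mono[OF fq_subspace_finite[OF that(2)] that(3)] fq_subspace_basis(1)[OF that(1)]
      fq_subspace_basis(1)[OF that(2)]
      card_field_gt_1[where 'a = 'a] by simp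
  have cardT: "real (card (T U)) = ?t r * ?g r" if "U \<in> G r" for U r
  proof -
    have U: "fq_subspace n U" "U \<subseteq> W" "fq_dim n U = r" using that by (auto simp: G_def)
    have rw: "r \<le> w" using dim_mono[OF U(1) W U(2)] U(3) by (simp add: w_def W_def)
    show ?thesis
    proof (cases "r \<le> N")
      case True
      have "(int w + 1 - int r) * (int N - int r) = int ((Suc w - r) * (N - r))"
        using True rw by (simp add: of_nat_diff)
      then have "?t r = real CARD('a) ^ ((Suc w - r) * (N - r))"
        by (simp only: power_int_of_nat)
      moreover have "real (card (T U)) = real CARD('a) ^ ((Suc w - r) * (N - r)) * ?g r"
        using card_subspaces_with_Int_eq_gauss_coeff[OF S U(1) W' _ W'S, of N] U WW' True dimW'
        by (simp add: T_def d_def algebra_simps)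
      ultimately show ?thesis by simp
    next
      \<comment> \<open>For \<open>r > N\<close> the exponent of \<open>powi\<close> is negative,
        but the term vanishes through its last Gaussian coefficient, and no
        \<open>N\<close>-dimensional \<open>L\<close> contains \<open>U\<close>.\<close>
      case False
      then have "T U = {}" using dim_mono[OF U(1)] U(3) by (force simp: T_def)
      moreover have "?g r = 0" using False by (simp add: gauss_coeff_def)
      ultimately show ?thesis by simp
    qed
  qed
  \<comment> \<open>For a bad \<open>L\<close> the intersection with \<open>W'\<close> is already
    the one with \<open>W\<close>, so \<open>U\<close> ranges over subspaces of \<open>W\<close>
    only.\<close>
  have "?B \<subseteq> (\<Union>r\<in>{0..w}. \<Union>U\<in>G r. T U)"
  proof
    fix L assume "L \<in> ?B"
    then have L: "fq_subspace n L" "L \<subseteq> S" "fq_dim n L = N" "v \<notin> fq_sum n L X" by auto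
    have "L \<inter> W' = L \<inter> W"
      using Int_extend_span_eq_if_notin_fq_sum[OF L(1,2) X S _ L(4)] v by (simp add: W_def W'_def)
    moreover have "fq_subspace n (L \<inter> W)" using L(1) W by (rule fq_subspace_Int)
    moreover have "fq_dim n (L \<inter> W) \<le> w"
      using dim_mono[OF calculation(2) W Int_lower2] by (simp add: w_def W_def)
    ultimately show "L \<in> (\<Union>r\<in>{0..w}. \<Union>U\<in>G r. T U)" using L by (auto simp: G_def T_def)
  qed
  then have "card ?B \<le> card (\<Union>r\<in>{0..w}. \<Union>U\<in>G r. T U)"
    using finG finT by (intro card_mono) auto
  also have "\<dots> \<le> (\<Sum>r=0..w. \<Sum>U\<in>G r. card (T U))"
    by (rule order_trans[OF card_UN_le]) (auto intro!: sum_mono card_UN_le finG)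
  finally have "real (card ?B) \<le> (\<Sum>r=0..w. \<Sum>U\<in>G r. real (card (T U)))"
    by (simp flip: of_nat_sum)
  also have "\<dots> = (\<Sum>r=0..w. real (card (G r)) * (?t r * ?g r))"
    using cardT by simp
  also have "\<dots> = (\<Sum>r=0..w. ?t r * real (gauss_coeff TYPE('a) (int w) (int r)) * ?g r)"
    using card_subspaces_eq_gauss_coeff[OF W] by (simp add: G_def w_def W_def mult_ac)
  finally show ?thesis .
qed

section \<open>A linear index code from a good subspace\<close>

text \<open>Sending \<open>M X\<close>, where the rows of \<open>M\<close> form a basis of
  \<open>L\<close>, reveals \<open>l X\<close> for every \<open>l\<close> in \<open>L\<close>, and
  the side information reveals \<open>x X\<close> for every \<open>x\<close> in \<open>XI i\<close>.
  A decomposition of \<open>R_i\<close> as \<open>l + x\<close> therefore recovers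
  \<open>R_i X\<close>.\<close>

lemma linear_index_code_exists:
  fixes XS L :: "'a :: {field, finite} vec set"
  assumes VS: "generating_matrix n XS VS" and R: "R \<in> carrier_mat m n"
    and VI: "\<And>i. i < m \<Longrightarrow> generating_matrix n (XI i) (VI i)"
    and L: "fq_subspace n L" "L \<subseteq> XS"
    and mem: "\<And>i. i < m \<Longrightarrow> row R i \<in> fq_sum n L (XI i)"
  shows "\<exists>E. index_code t m n XI R VI (fq_dim n L) E \<and> linear_code t n XS VS (fq_dim n L) E"
proof -
  interpret vec_space "TYPE('a)" n .
  define N where "N = fq_dim n L"
  define d where "d = fq_dim n XS"
  have VSc: "VS \<in> carrier_mat d n" and VSr: "row_space VS = XS"
    using VS by (auto simp: generating_matrix_def d_def)
  obtain B where B: "finite B" "card B = N" "B \<subseteq> L" "span B = L"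
    using fq_subspace_basis(2)[OF L(1)] by (auto simp: N_def)
  then obtain bs where bs: "set bs = B" "length bs = N"
    using finite_distinct_list distinct_card by metis
  \<comment> \<open>Each vector of \<open>XS\<close> is a combination of the rows of
    \<open>VS\<close>. The coefficient vectors of the generators of \<open>L\<close> become the rows
    of \<open>A\<close>, so that \<open>A * VS\<close> has the generators as rows and the code is
    linear in the required form.\<close>
  have "\<exists>y\<in>carrier_vec d. VS\<^sup>T *\<^sub>v y = b" if "b \<in> XS" for b
    using that VSc unfolding VSr[symmetric] row_space_eq[OF VSc] by auto
  then obtain y where y: "\<And>b. b \<in> XS \<Longrightarrow> y b \<in> carrier_vec d \<and> VS\<^sup>T *\<^sub>v y b = b" by metis
  define A where "A = mat_of_rows d (map y bs)"
  define M where "M = A * VS"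
  have Ac: "A \<in> carrier_mat N d" using mat_of_rows_carrier(1)[of d "map y bs"] by (simp add: A_def bs(2))
  have Mc: "M \<in> carrier_mat N n" using Ac VSc by (simp add: M_def)
  have "rows M = bs"
  proof (rule nth_equalityI)
    show "length (rows M) = length bs" using Mc bs(2) by simp
    fix j assume "j < length (rows M)"
    then have j: "j < N" using Mc by simp
    then have bj: "bs ! j \<in> XS" using bs B(3) L(2) nth_mem by blast
    have "row A j = y (bs ! j)" using j bs(2) y[OF bj] by (simp add: A_def)
    then have "row M j = VS\<^sup>T *\<^sub>v y (bs ! j)"
      unfolding M_def using j Ac VSc y[OF bj, THEN conjunct1]
      by (intro eq_vecI) (auto simp: comm_scalar_prod[of _ d])
    then show "rows M ! j = bs ! j" using y[OF bj] j Mc by simp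
  qed
  then have row_M: "row_space M = L" by (simp add: row_space_def bs(1) B(4))
  define E where "E X = M * X" for X :: "'a mat"
  have "\<exists>D \<in> carrier_mat N t \<times> carrier_mat (fq_dim n (XI i)) t \<rightarrow> carrier_vec t.
        \<forall>X \<in> carrier_mat n t. D (E X, VI i * X) = row (R * X) i" if i: "i < m" for i
  proof -
    define di where "di = fq_dim n (XI i)"
    have Vc: "VI i \<in> carrier_mat di n" and Vr: "row_space (VI i) = XI i"
      using VI[OF i] by (auto simp: generating_matrix_def di_def)
    obtain l x where Ri: "row R i = l + x" and l: "l \<in> L" and x: "x \<in> XI i"
      using mem[OF i] unfolding fq_sum_eq by auto
    obtain a where a: "a \<in> carrier_vec N" "M\<^sup>T *\<^sub>v a = l"
      using l Mc unfolding row_M[symmetric] row_space_eq[OF Mc] by auto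
    obtain b where b: "b \<in> carrier_vec di" "(VI i)\<^sup>T *\<^sub>v b = x"
      using x Vc unfolding Vr[symmetric] row_space_eq[OF Vc] by auto
    \<comment> \<open>The decoder combines the rows of the received matrix with the coefficients
      \<open>a\<close> of \<open>l\<close>, and the rows of the side information with the
      coefficients \<open>b\<close> of \<open>x\<close>. Transposes express these row combinations
      as matrix-vector products.\<close>
    define D where "D = (\<lambda>(Y :: 'a mat, Z :: 'a mat). Y\<^sup>T *\<^sub>v a + Z\<^sup>T *\<^sub>v b)"
    have "D \<in> carrier_mat N t \<times> carrier_mat di t \<rightarrow> carrier_vec t"
    proof (rule funcsetI)
      fix YZ :: "'a mat \<times> 'a mat" assume "YZ \<in> carrier_mat N t \<times> carrier_mat di t"
      then show "D YZ \<in> carrier_vec t"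
        by (intro carrier_vecI) (auto simp: D_def)
    qed
    moreover have "D (E X, VI i * X) = row (R * X) i" if X: "X \<in> carrier_mat n t" for X
    proof -
      have "D (E X, VI i * X) = (M * X)\<^sup>T *\<^sub>v a + (VI i * X)\<^sup>T *\<^sub>v b" by (simp add: D_def E_def)
      also have "\<dots> = X\<^sup>T *\<^sub>v l + X\<^sup>T *\<^sub>v x"
        using X Mc Vc a b by (simp add: transpose_mult assoc_mult_mat_vec[of _ t n])
      also have "\<dots> = X\<^sup>T *\<^sub>v row R i"
        unfolding Ri using X a b Mc Vc
        by (intro mult_add_distrib_mat_vec[symmetric, of _ t n]) auto
      also have "\<dots> = row (R * X) i"
        using X R i by (intro eq_vecI) (auto simp: comm_scalar_prod[of _ n])
      finally show ?thesis .
    qed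
    ultimately show ?thesis unfolding di_def by blast
  qed
  moreover have "E \<in> carrier_mat n t \<rightarrow> carrier_mat N t" using Mc by (auto simp: E_def)
  ultimately have "index_code t m n XI R VI N E" by (simp add: index_code_def)
  moreover have "linear_code t n XS VS N E"
    using Ac by (auto simp: linear_code_def E_def M_def d_def)
  ultimately show ?thesis unfolding N_def by blast
qed

section \<open>Union bound and both claims\<close>

theorem mainTheorem5:
  fixes t m n N :: nat
    and XX :: "'a :: {field, finite} mat set"
    and XI :: "nat \<Rightarrow> 'a vec set"
    and XS :: "'a vec set"
    and R VS :: "'a mat"
    and VI :: "nat \<Rightarrow> 'a mat"
    and dS :: nat
    and w :: "nat \<Rightarrow> nat"
  assumes "iccsi_instance t m n XX XI XS R"
    and "generating_matrix n XS VS"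
    and "\<And>i. i < m \<Longrightarrow> generating_matrix n (XI i) (VI i)"
    and "dS = fq_dim n XS"
    and "\<And>i. i < m \<Longrightarrow> w i = fq_dim n (XI i \<inter> XS)"
    and "N > 0"
  shows
    "(N \<le> dS \<longrightarrow>
       measure_pmf.prob (pmf_of_set {L. fq_subspace n L \<and> L \<subseteq> XS \<and> fq_dim n L = N})
         {L. \<forall>i<m. row R i \<in> fq_sum n L (XI i)}
       \<ge> 1 - inverse (real (gauss_coeff TYPE('a) (int dS) (int N))) *
           (\<Sum>i<m. \<Sum>r=0..w i.
              real CARD('a) powi ((int (w i) + 1 - int r) * (int N - int r)) *
              real (gauss_coeff TYPE('a) (int (w i)) (int r)) *
              real (gauss_coeff TYPE('a) (int dS - int (w i) - 1) (int N - int r))))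
     \<and>
     ((\<Sum>i<m. \<Sum>r=0..w i.
          real CARD('a) powi ((int (w i) + 1 - int r) * (int N - int r)) *
          real (gauss_coeff TYPE('a) (int (w i)) (int r)) *
          real (gauss_coeff TYPE('a) (int dS - int (w i) - 1) (int N - int r)))
        < real (gauss_coeff TYPE('a) (int dS) (int N))
      \<longrightarrow> (\<exists>E. index_code t m n XI R VI N E \<and> linear_code t n XS VS N E))"
proof -
  let ?q = "real CARD('a)"
  define b where "b i = (\<Sum>r=0..w i.
      ?q powi ((int (w i) + 1 - int r) * (int N - int r)) *
      real (gauss_coeff TYPE('a) (int (w i)) (int r)) *
      real (gauss_coeff TYPE('a) (int dS - int (w i) - 1) (int N - int r)))" for i
  define g where "g = gauss_coeff TYPE('a) (int dS) (int N)"
  define G where "G = {L. fq_subspace n L \<and> L \<subseteq> XS \<and> fq_dim n L = N}"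
  define good where "good = {L. \<forall>i<m. row R i \<in> fq_sum n L (XI i)}"
  define bad where "bad i = {L \<in> G. row R i \<notin> fq_sum n L (XI i)}" for i
  have XS: "fq_subspace n XS" and XI: "\<And>i. i < m \<Longrightarrow> fq_subspace n (XI i)"
    and R: "R \<in> carrier_mat m n" and Ri: "\<And>i. i < m \<Longrightarrow> row R i \<in> XS - XI i"
    using assms(1) by (auto simp: iccsi_instance_def)
  have finG: "finite G" using fq_subspace_finite[OF XS] by (simp add: G_def)
  have cardG: "card G = g"
    using card_subspaces_eq_gauss_coeff[OF XS] assms(4) by (simp add: G_def g_def)
  have "real (card (bad i)) \<le> b i" if "i < m" for i
    using card_subspaces_notin_fq_sum_le[OF XS XI[OF that] Ri[OF that], of N] that assms(4,5)
    by (simp add: bad_def G_def b_def)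
  then have "(\<Sum>i<m. real (card (bad i))) \<le> (\<Sum>i<m. b i)" by (intro sum_mono) auto
  moreover have "card (\<Union>i<m. bad i) \<le> (\<Sum>i<m. card (bad i))" by (rule card_UN_le) simp
  moreover have "card G \<le> card (G \<inter> good) + card (\<Union>i<m. bad i)"
  proof -
    have "G = (G \<inter> good) \<union> (\<Union>i<m. bad i)" by (auto simp: good_def bad_def)
    then show ?thesis using card_Un_le by metis
  qed
  \<comment> \<open>Both claims follow from this inequality: dividing by \<open>g\<close> gives the
    probability bound, and a positive left side gives a good subspace.\<close>
  ultimately have count: "real g - (\<Sum>i<m. b i) \<le> real (card (G \<inter> good))"
    unfolding cardG by (simp flip: of_nat_sum)
  have "1 - inverse (real g) * (\<Sum>i<m. b i) \<le> measure_pmf.prob (pmf_of_set G) good"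
    if "N \<le> dS"
  proof -
    have g: "0 < g" using gauss_coeff_pos[OF that] by (simp add: g_def)
    then have "G \<noteq> {}" using cardG by auto
    then have "measure_pmf.prob (pmf_of_set G) good = real (card (G \<inter> good)) / real g"
      using measure_pmf_of_set[OF _ finG] cardG by simp
    then show ?thesis using count g by (simp add: field_simps)
  qed
  moreover have "\<exists>E. index_code t m n XI R VI N E \<and> linear_code t n XS VS N E"
    if "(\<Sum>i<m. b i) < real g"
  proof -
    have "G \<inter> good \<noteq> {}" using count that by auto
    then obtain L where L: "fq_subspace n L" "L \<subseteq> XS" "fq_dim n L = N"
      "\<And>i. i < m \<Longrightarrow> row R i \<in> fq_sum n L (XI i)"
      by (auto simp: G_def good_def)
    then show ?thesis
      using linear_index_code_exists[OF assms(2) R assms(3) L(1,2,4), of t] L(3) by simp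
  qed
  ultimately show ?thesis unfolding b_def g_def G_def good_def by blast
qed

end
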